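(* Let $K$ be a field complete with respect to a discrete non-archimedean valuation $v$, with residue field $k$. Let $\mathcal{A}_1,\ldots,\mathcal{A}_n\subseteq\mathbb{Z}^n$ be nonempty finite sets. Assume that $\mathrm{char}(k)=0$ or that $\mathrm{char}(k)$ is coprime to the determinant of every matrix $M=[\alpha_1-\beta_1;\ldots;\alpha_n-\beta_n]$ (rows $\alpha_i-\beta_i$) with $\alpha_i,\beta_i\in\mathcal{A}_i$ for $i=1,\ldots,n$ and $\det(M)\neq0$. Then any tropically generic system of polynomials $F=(f_1,\ldots,f_n)$ in $K[X_1^{\pm1},\ldots,X_n^{\pm1}]$ with $\mathrm{supp}(f_i)=\mathcal{A}_i$ for $i=1,\ldots,n$ is regular.
   Context: Tropical genericity: a property $P$ of points of $(K^\ast)^N$ is true for any tropically generic $x\in(K^\ast)^N$ if the set $\{v(x): x\in(K^\ast)^N,\ P(x)\text{ false}\}$ is contained in a finite union of (affine) hyperplanes of $\mathbb{R}^N$. Here the supports are fixed, $N=|\mathcal{A}_1|+\cdots+|\mathcal{A}_n|$, and systems $F=(f_1,\ldots,f_n)$ with $\mathrm{supp}(f_i)=\mathcal{A}_i$ (exact support, all coefficients nonzero) are identified with their coefficient vectors in $(K^\ast)^N$. Let $v:K\to\mathbb{R}\cup\{\infty\}$ be the discrete (nontrivial) valuation, $A=\{x: v(x)\ge 0\}$ the valuation ring, $\mathfrak{M}=\pi A$ its maximal ideal with a fixed generator $\pi$, $k=A/\mathfrak{M}$. The first digit of $x\in K^\ast$ is $\delta(x)=\pi^{-v(x)/v(\pi)}x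 \bmod \mathfrak{M}\in k^\ast$. For a nonzero $f=\sum_{i=1}^t a_iX^{\alpha_i}\in K[X_1^{\pm1},\ldots,X_n^{\pm1}]$ (with $a_i\in K^\ast$ and distinct $\alpha_i\in\mathbb{Z}^n$) and $w\in\mathbb{R}^n$, put $l_i(f;w)=v(a_i)+\alpha_i\cdot w$ and $\mathrm{tr}(f;w)=\min_i l_i(f;w)$. The set $\mathrm{Trop}(f)\subseteq\mathbb{R}^n$ consists of the points where $\mathrm{tr}(f;\cdot)$ is not differentiable (equivalently, where the minimum is attained by at least two indices $i$). The lower polynomial is $f^{[w]}=\sum_{i:\,l_i(f;w)=\mathrm{tr}(f;w)}a_iX^{\alpha_i}$ and the initial form is $\mathrm{in}_w(f)=\sum_{i:\,l_i(f;w)=\mathrm{tr}(f;w)}\delta(a_i)X^{\alpha_i}\in k[X_1^{\pm1},\ldots,X_n^{\pm1}]$. For a system $F$: $\mathrm{Trop}(F)=\bigcap_i\mathrm{Trop}(f_i)$, and $F^{[w]}$, $\mathrm{in}_w(F)$ are defined componentwise. A zero of a square system is degenerate if the Jacobian determinant of the system vanishes at it. $F$ is semiregular at $w\in\mathbb{R}^n$ if either $w\notin\mathrm{Trop}(F)\cap v(\pi)\mathbb{Z}^n$ or $\mathrm{in}_w(F)$ has no degenerate zero in $(k^\ast)^n$. $F$ is regular if $\mathrm{Trop}(F)$ is finite and, for all $w\in\mathrm{Trop}(F)$, $F^{[w]}$ consists solely of binomials and $F$ is semiregular at $w$. *)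

theory Defs
  imports "HOL-Analysis.Analysis" "HOL-Library.Poly_Mapping"
begin

locale complete_discretely_valued_field =
  fixes v :: "'k::field \<Rightarrow> ereal"
  assumes v_eq_infinity_iff: "v x = \<infinity> \<longleftrightarrow> x = 0"
    and v_neq_minus_infinity: "v x \<noteq> - \<infinity>"
    and v_mult: "v (x * y) = v x + v y"
    and v_add: "min (v x) (v y) \<le> v (x + y)"
    and v_discrete:
      "\<exists>c>0. {real_of_ereal (v x) |x. x \<noteq> 0} = {c * real_of_int m |m. True}"
    and v_complete:
      "(\<And>C::real. \<exists>N. \<forall>i\<ge>N. \<forall>j\<ge>N. ereal C \<le> v (X i - X j)) \<Longrightarrow>
        \<exists>L. \<forall>C::real. \<exists>N. \<forall>i\<ge>N. ereal C \<le> v (X (i::nat) - L)"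

definition valuation_ring :: "('k::field \<Rightarrow> ereal) \<Rightarrow> 'k set" where
  "valuation_ring v = {x. 0 \<le> v x}"

definition maximal_ideal :: "('k::field \<Rightarrow> ereal) \<Rightarrow> 'k set" where
  "maximal_ideal v = {x. 0 < v x}"

definition uniformizer :: "('k::field \<Rightarrow> ereal) \<Rightarrow> 'k \<Rightarrow> bool" where
  "uniformizer v \<pi> \<longleftrightarrow> maximal_ideal v = (*) \<pi> ` valuation_ring v"

text \<open>
  The residue field is a type \<open>'r\<close> together with a surjective ring homomorphism from
  the valuation ring onto \<open>'r\<close> whose kernel is the maximal ideal. Values of
  \<open>res\<close> outside the valuation ring are irrelevant.
\<close>

definition residue_map :: "('k::field \<Rightarrow> ereal) \<Rightarrow> ('k \<Rightarrow> 'r::field) \<Rightarrow> bool" where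
  "residue_map v res \<longleftrightarrow>
    res 1 = 1 \<and>
    (\<forall>x\<in>valuation_ring v. \<forall>y\<in>valuation_ring v.
      res (x + y) = res x + res y \<and> res (x * y) = res x * res y) \<and>
    res ` valuation_ring v = UNIV \<and>
    {x \<in> valuation_ring v. res x = 0} = maximal_ideal v"

abbreviation val :: "('k::field \<Rightarrow> ereal) \<Rightarrow> 'k \<Rightarrow> real" where
  "val v x \<equiv> real_of_ereal (v x)"

text \<open>For \<open>x \<noteq> 0\<close> the quotient \<open>val v x / val v \<pi>\<close> is an integer, so the floor only
  serves to convert its type.\<close>

definition first_digit :: "('k::field \<Rightarrow> ereal) \<Rightarrow> 'k \<Rightarrow> ('k \<Rightarrow> 'r::field) \<Rightarrow> 'k \<Rightarrow> 'r" where
  "first_digit v \<pi> res x = res (\<pi> powi (- \<lfloor>val v x / val v \<pi>\<rfloor>) * x)"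

text \<open>
  The ring of finitely supported functions on the group \<open>int ^ 'n\<close> with convolution
  product: \<open>keys f\<close> is the support and \<open>lookup f \<alpha>\<close> the coefficient of \<open>X\<^sup>\<alpha>\<close>.
\<close>

type_synonym ('a, 'n) laurent_poly = "(int ^ 'n) \<Rightarrow>\<^sub>0 'a"

definition laurent_eval :: "('a::field, 'n::finite) laurent_poly \<Rightarrow> 'a ^ 'n \<Rightarrow> 'a" where
  "laurent_eval f x = (\<Sum>\<alpha>\<in>Poly_Mapping.keys f. Poly_Mapping.lookup f \<alpha> * (\<Prod>i\<in>UNIV. (x $ i) powi (\<alpha> $ i)))"

definition laurent_pderiv :: "'n::finite \<Rightarrow> ('a::field, 'n) laurent_poly \<Rightarrow> ('a, 'n) laurent_poly" where
  "laurent_pderiv j f =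
    (\<Sum>\<alpha>\<in>Poly_Mapping.keys f. Poly_Mapping.single (\<alpha> - axis j 1) (of_int (\<alpha> $ j) * Poly_Mapping.lookup f \<alpha>))"

definition torus_zero :: "('n \<Rightarrow> ('a::field, 'n::finite) laurent_poly) \<Rightarrow> 'a ^ 'n \<Rightarrow> bool" where
  "torus_zero F x \<longleftrightarrow> (\<forall>i. x $ i \<noteq> 0) \<and> (\<forall>i. laurent_eval (F i) x = 0)"

definition degenerate_torus_zero :: "('n \<Rightarrow> ('a::field, 'n::finite) laurent_poly) \<Rightarrow> 'a ^ 'n \<Rightarrow> bool" where
  "degenerate_torus_zero F x \<longleftrightarrow>
    torus_zero F x \<and> det (\<chi> i j. laurent_eval (laurent_pderiv j (F i)) x) = 0"

definition trop_term ::
  "('k::field \<Rightarrow> ereal) \<Rightarrow> ('k, 'n::finite) laurent_poly \<Rightarrow> real ^ 'n \<Rightarrow> int ^ 'n \<Rightarrow> real" where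
  "trop_term v f w \<alpha> = val v (Poly_Mapping.lookup f \<alpha>) + (\<chi> i. real_of_int (\<alpha> $ i)) \<bullet> w"

definition tr :: "('k::field \<Rightarrow> ereal) \<Rightarrow> ('k, 'n::finite) laurent_poly \<Rightarrow> real ^ 'n \<Rightarrow> real" where
  "tr v f w = Min (trop_term v f w ` Poly_Mapping.keys f)"

definition Trop :: "('k::field \<Rightarrow> ereal) \<Rightarrow> ('k, 'n::finite) laurent_poly \<Rightarrow> (real ^ 'n) set" where
  "Trop v f = {w. \<not> tr v f differentiable (at w)}"

definition min_exponents ::
  "('k::field \<Rightarrow> ereal) \<Rightarrow> ('k, 'n::finite) laurent_poly \<Rightarrow> real ^ 'n \<Rightarrow> (int ^ 'n) set" where
  "min_exponents v f w = {\<alpha> \<in> Poly_Mapping.keys f. trop_term v f w \<alpha> = tr v f w}"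

definition lower_poly ::
  "('k::field \<Rightarrow> ereal) \<Rightarrow> real ^ 'n::finite \<Rightarrow> ('k, 'n) laurent_poly \<Rightarrow> ('k, 'n) laurent_poly" where
  "lower_poly v w f = (\<Sum>\<alpha>\<in>min_exponents v f w. Poly_Mapping.single \<alpha> (Poly_Mapping.lookup f \<alpha>))"

definition initial_form ::
  "('k::field \<Rightarrow> ereal) \<Rightarrow> 'k \<Rightarrow> ('k \<Rightarrow> 'r::field) \<Rightarrow> real ^ 'n::finite \<Rightarrow>
    ('k, 'n) laurent_poly \<Rightarrow> ('r, 'n) laurent_poly" where
  "initial_form v \<pi> res w f =
    (\<Sum>\<alpha>\<in>min_exponents v f w. Poly_Mapping.single \<alpha> (first_digit v \<pi> res (Poly_Mapping.lookup f \<alpha>)))"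

definition Trop_system ::
  "('k::field \<Rightarrow> ereal) \<Rightarrow> ('n \<Rightarrow> ('k, 'n::finite) laurent_poly) \<Rightarrow> (real ^ 'n) set" where
  "Trop_system v F = (\<Inter>i. Trop v (F i))"

definition is_binomial :: "('a::zero, 'n::finite) laurent_poly \<Rightarrow> bool" where
  "is_binomial f \<longleftrightarrow> card (Poly_Mapping.keys f) = 2"

definition semiregular_at ::
  "('k::field \<Rightarrow> ereal) \<Rightarrow> 'k \<Rightarrow> ('k \<Rightarrow> 'r::field) \<Rightarrow>
    ('n \<Rightarrow> ('k, 'n::finite) laurent_poly) \<Rightarrow> real ^ 'n \<Rightarrow> bool" where
  "semiregular_at v \<pi> res F w \<longleftrightarrow>
    w \<notin> Trop_system v F \<inter> {\<chi> i. val v \<pi> * real_of_int (z $ i) |z. True} \<or>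
    (\<nexists>x. degenerate_torus_zero (\<lambda>i. initial_form v \<pi> res w (F i)) x)"

definition regular_system ::
  "('k::field \<Rightarrow> ereal) \<Rightarrow> 'k \<Rightarrow> ('k \<Rightarrow> 'r::field) \<Rightarrow>
    ('n \<Rightarrow> ('k, 'n::finite) laurent_poly) \<Rightarrow> bool" where
  "regular_system v \<pi> res F \<longleftrightarrow>
    finite (Trop_system v F) \<and>
    (\<forall>w\<in>Trop_system v F.
      (\<forall>i. is_binomial (lower_poly v w (F i))) \<and> semiregular_at v \<pi> res F w)"

text \<open>
  For a finite index set \<open>I\<close>, the spaces of vectors with coordinates indexed by \<open>I\<close> are
  modelled by the extensional functions on \<open>I\<close>.
\<close>

definition affine_hyperplane :: "'i set \<Rightarrow> ('i \<Rightarrow> real) set \<Rightarrow> bool" where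
  "affine_hyperplane I H \<longleftrightarrow>
    (\<exists>c b. (\<exists>j\<in>I. c j \<noteq> 0) \<and> H = {y \<in> I \<rightarrow>\<^sub>E UNIV. (\<Sum>j\<in>I. c j * y j) = b})"

definition tropically_generic ::
  "('k::field \<Rightarrow> ereal) \<Rightarrow> 'i set \<Rightarrow> (('i \<Rightarrow> 'k) \<Rightarrow> bool) \<Rightarrow> bool" where
  "tropically_generic v I P \<longleftrightarrow>
    (\<exists>\<H>. finite \<H> \<and> (\<forall>H\<in>\<H>. affine_hyperplane I H) \<and>
      {\<lambda>j\<in>I. val v (x j) |x. x \<in> I \<rightarrow>\<^sub>E (UNIV - {0}) \<and> \<not> P x} \<subseteq> \<Union>\<H>)"

definition system_of ::
  "('n \<Rightarrow> (int ^ 'n) set) \<Rightarrow> ('n \<times> (int ^ 'n) \<Rightarrow> 'k::field) \<Rightarrow>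
    'n \<Rightarrow> ('k, 'n::finite) laurent_poly" where
  "system_of \<A> x i = (\<Sum>\<alpha>\<in>\<A> i. Poly_Mapping.single \<alpha> (x (i, \<alpha>)))"

lemma lookup_system_of:
  assumes "finite (\<A> i)"
  shows "Poly_Mapping.lookup (system_of \<A> x i) \<alpha> = (if \<alpha> \<in> \<A> i then x (i, \<alpha>) else 0)"
  using assms by (simp add: system_of_def lookup_sum lookup_single when_def)

lemma bij_betw_system_of:
  assumes "\<And>i. finite (\<A> i)"
  shows "bij_betw (system_of \<A>) (Sigma UNIV \<A> \<rightarrow>\<^sub>E (UNIV - {0})) {F. \<forall>i. Poly_Mapping.keys (F i) = \<A> i}"
proof (rule bij_betw_byWitness[where f' = "\<lambda>F. \<lambda>(i, \<alpha>)\<in>Sigma UNIV \<A>. Poly_Mapping.lookup (F i) \<alpha>"])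
  note lk = lookup_system_of[OF assms]
  show "\<forall>x\<in>Sigma UNIV \<A> \<rightarrow>\<^sub>E (UNIV - {0}).
      (\<lambda>(i, \<alpha>)\<in>Sigma UNIV \<A>. Poly_Mapping.lookup (system_of \<A> x i) \<alpha>) = x"
    by (auto simp: lk fun_eq_iff PiE_def extensional_def)
  show "\<forall>F\<in>{F. \<forall>i. Poly_Mapping.keys (F i) = \<A> i}.
      system_of \<A> (\<lambda>(i, \<alpha>)\<in>Sigma UNIV \<A>. Poly_Mapping.lookup (F i) \<alpha>) = F"
    by (auto simp: lk intro!: ext poly_mapping_eqI) (metis in_keys_iff)
  show "system_of \<A> ` (Sigma UNIV \<A> \<rightarrow>\<^sub>E (UNIV - {0})) \<subseteq> {F. \<forall>i. Poly_Mapping.keys (F i) = \<A> i}"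
    by (auto simp: lk in_keys_iff PiE_def Pi_def split: if_splits)
  show "(\<lambda>F. \<lambda>(i, \<alpha>)\<in>Sigma UNIV \<A>. Poly_Mapping.lookup (F i) \<alpha>) ` {F. \<forall>i. Poly_Mapping.keys (F i) = \<A> i}
      \<subseteq> Sigma UNIV \<A> \<rightarrow>\<^sub>E (UNIV - {0})"
    by (auto split: if_splits) (metis in_keys_iff)
qed

end

theory Submission
  imports Defs
begin

text \<open>
  The proof is linear algebra on the Cayley configuration. Attach to the monomial
  \<open>X\<^sup>\<alpha>\<close> of the \<open>i\<close>-th polynomial the vector \<open>(e\<^sub>i, \<alpha>)\<close> in a space of dimension \<open>2n\<close>.
  That the term of \<open>\<alpha>\<close> is minimal at \<open>w\<close> in \<open>f\<^sub>i\<close> then says that the valuation of its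
  coefficient is the inner product of \<open>(e\<^sub>i, \<alpha>)\<close> with the single vector
  \<open>(tr(f\<^sub>1;w), \<dots>, tr(f\<^sub>n;w), -w)\<close>. Hence a linear relation between the vectors of minimal
  terms forces the same relation between valuations of coefficients, which confines the
  valuation vector to a hyperplane. Since only finitely many sets of monomials can be minimal,
  finitely many hyperplanes suffice to ensure that for every \<open>w\<close> the vectors of the minimal
  terms are linearly independent (\<open>generic_equations_independent\<close>).

  Regularity follows from this independence. At a point of \<open>Trop(F)\<close> each \<open>f\<^sub>i\<close> has at least two
  minimal terms (\<open>two_minimizers_on_Trop\<close>), so there are at least \<open>2n\<close> independent vectors in
  dimension \<open>2n\<close>: each \<open>f\<^sub>i\<close> has exactly two, and together they form a basis
  (\<open>binomial_and_spanning\<close>). A vector is determined by its inner products with a basis, so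
  \<open>w\<close> is determined by the set of minimal terms, and \<open>Trop(F)\<close> is finite. For the same reason
  the exponent differences \<open>\<alpha>\<^sub>i - \<beta>\<^sub>i\<close> of the \<open>n\<close> binomials have nonzero determinant. At a zero in
  the torus, the Jacobian determinant of a binomial system is this integer times a unit
  (\<open>binomial_system_nondegenerate\<close>), and the hypothesis on the residue characteristic says
  that the integer does not vanish in the residue field. So no zero of the initial forms is
  degenerate.
\<close>

section \<open>General position for linear equations\<close>

text \<open>
  The equations \<open>\<phi> j \<bullet> p = y j\<close> that hold at one point \<open>p\<close> transfer every linear relation between
  their normals \<open>\<phi> j\<close> to the right-hand sides \<open>y j\<close>. One relation for each dependent subfamily,
  of which there are finitely many, is enough to exclude.
\<close>

lemma generic_equations_independent:
  fixes \<phi> :: "'i \<Rightarrow> 'e::euclidean_space"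
  assumes fin: "finite I" and inj: "inj_on \<phi> I"
  obtains \<H> where "finite \<H>" and "\<forall>H\<in>\<H>. affine_hyperplane I H"
    and "\<And>y p. y \<in> I \<rightarrow>\<^sub>E UNIV \<Longrightarrow> y \<notin> \<Union>\<H> \<Longrightarrow> independent (\<phi> ` {j \<in> I. \<phi> j \<bullet> p = y j})"
proof -
  \<comment> \<open>Relations are extended by zero to all of \<open>I\<close>, so that they are equations of hyperplanes.\<close>
  define relation where "relation S c \<longleftrightarrow> (\<exists>j\<in>I. c j \<noteq> 0) \<and> (\<forall>j. j \<notin> S \<longrightarrow> c j = 0)
      \<and> (\<Sum>j\<in>I. c j *\<^sub>R \<phi> j) = 0" for S and c :: "'i \<Rightarrow> real"
  define hyp where "hyp S = {y \<in> I \<rightarrow>\<^sub>E UNIV. (\<Sum>j\<in>I. (SOME c. relation S c) j * y j) = 0}" for S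
  define \<H> where "\<H> = hyp ` {S \<in> Pow I. \<exists>c. relation S c}"
  show thesis
  proof
    show "finite \<H>" unfolding \<H>_def using fin by simp
    show "\<forall>H\<in>\<H>. affine_hyperplane I H"
    proof
      fix H assume "H \<in> \<H>"
      then obtain S where S: "\<exists>c. relation S c" "H = hyp S" by (auto simp: \<H>_def)
      have "relation S (SOME c. relation S c)" using S(1) by (rule someI_ex)
      then show "affine_hyperplane I H"
        unfolding affine_hyperplane_def S(2) hyp_def relation_def by blast
    qed
    fix y p assume y: "y \<in> I \<rightarrow>\<^sub>E UNIV" "y \<notin> \<Union>\<H>"
    define S where "S = {j \<in> I. \<phi> j \<bullet> p = y j}"
    have SI: "S \<subseteq> I" by (auto simp: S_def)
    have finS: "finite S" using SI fin by (rule finite_subset)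
    have injS: "inj_on \<phi> S" using inj SI by (rule inj_on_subset)
    show "independent (\<phi> ` {j \<in> I. \<phi> j \<bullet> p = y j})"
      unfolding S_def[symmetric]
    proof (rule ccontr)
      assume "\<not> independent (\<phi> ` S)"
      then obtain u where u: "\<exists>j\<in>S. u (\<phi> j) \<noteq> 0" "(\<Sum>e\<in>\<phi> ` S. u e *\<^sub>R e) = 0"
        using dependent_finite[of "\<phi> ` S"] finS by auto
      define c where "c j = (if j \<in> S then u (\<phi> j) else 0)" for j
      have "(\<Sum>j\<in>I. c j *\<^sub>R \<phi> j) = (\<Sum>j\<in>S. u (\<phi> j) *\<^sub>R \<phi> j)"
        by (rule sum.mono_neutral_cong_right) (use fin SI in \<open>auto simp: c_def\<close>)
      also have "\<dots> = 0" using u(2) by (simp add: sum.reindex[OF injS])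
      finally have "relation S c"
        using u(1) SI unfolding relation_def c_def by auto
      then have ex: "\<exists>c. relation S c" by blast
      define d where "d = (SOME c. relation S c)"
      have d: "relation S d" unfolding d_def using ex by (rule someI_ex)
      have "(\<Sum>j\<in>I. d j * y j) = (\<Sum>j\<in>I. (d j *\<^sub>R \<phi> j) \<bullet> p)"
        by (rule sum.cong) (use d in \<open>auto simp: relation_def S_def\<close>)
      also have "\<dots> = (\<Sum>j\<in>I. d j *\<^sub>R \<phi> j) \<bullet> p" by (rule inner_sum_left[symmetric])
      also have "\<dots> = 0" using d by (simp add: relation_def)
      finally have "y \<in> hyp S" using y(1) by (simp add: hyp_def d_def)
      moreover have "hyp S \<in> \<H>" using SI ex by (auto simp: \<H>_def)
      ultimately show False using y(2) by blast
    qed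
  qed
qed

section \<open>Determinants\<close>

lemma of_int_det:
  fixes M :: "int ^ 'n::finite ^ 'n"
  shows "(of_int (det M) :: 'a::comm_ring_1) = det (\<chi> i j. of_int (M $ i $ j))"
  by (simp add: det_def)

lemma det_scale_rows_cols:
  fixes M :: "'a::comm_ring_1 ^ 'n::finite ^ 'n"
  shows "det (\<chi> i j. a i * M $ i $ j * b j) = prod a UNIV * prod b UNIV * det M"
proof -
  have "(\<Prod>i\<in>UNIV. a i * M $ i $ p i * b (p i)) = prod a UNIV * prod b UNIV * (\<Prod>i\<in>UNIV. M $ i $ p i)"
    if "p permutes UNIV" for p
    using prod.permute[OF that, of b] by (simp add: prod.distrib ac_simps o_def)
  then show ?thesis
    unfolding det_def sum_distrib_left by (intro sum.cong) (simp_all add: ac_simps)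
qed

text \<open>
  An integer vanishes in the field exactly when the characteristic divides it; together with
  coprimality this would make the characteristic a unit.
\<close>

lemma of_int_neq_0_of_coprime_char:
  assumes "d \<noteq> 0" and "CHAR('r::field) = 0 \<or> coprime (int CHAR('r)) d"
  shows "(of_int d :: 'r) \<noteq> 0"
proof
  assume "(of_int d :: 'r) = 0"
  then have dvd: "int CHAR('r) dvd d" by (simp add: of_int_eq_0_iff_char_dvd)
  with assms have "is_unit (int CHAR('r))"
    by (metis coprime_common_divisor dvd_0_left dvd_refl of_nat_0)
  then have "CHAR('r) = 1" by (simp add: zdvd1_eq)
  then show False using CHAR_not_1[where ?'a = 'r] by simp
qed

section \<open>Evaluation of Laurent polynomials\<close>

lemma laurent_eval_superset:
  assumes "finite T" and "Poly_Mapping.keys f \<subseteq> T"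
  shows "laurent_eval f x = (\<Sum>\<alpha>\<in>T. Poly_Mapping.lookup f \<alpha> * (\<Prod>i\<in>UNIV. (x $ i) powi (\<alpha> $ i)))"
  unfolding laurent_eval_def
  by (rule sum.mono_neutral_left) (use assms in \<open>auto simp: in_keys_iff\<close>)

lemma laurent_eval_add: "laurent_eval (f + g) x = laurent_eval f x + laurent_eval g x"
proof -
  let ?T = "Poly_Mapping.keys f \<union> Poly_Mapping.keys g"
  have "laurent_eval (f + g) x
      = (\<Sum>\<alpha>\<in>?T. Poly_Mapping.lookup (f + g) \<alpha> * (\<Prod>i\<in>UNIV. (x $ i) powi (\<alpha> $ i)))"
    by (rule laurent_eval_superset) (use keys_add[of f g] in auto)
  moreover have "laurent_eval f x
      = (\<Sum>\<alpha>\<in>?T. Poly_Mapping.lookup f \<alpha> * (\<Prod>i\<in>UNIV. (x $ i) powi (\<alpha> $ i)))"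
    by (rule laurent_eval_superset) auto
  moreover have "laurent_eval g x
      = (\<Sum>\<alpha>\<in>?T. Poly_Mapping.lookup g \<alpha> * (\<Prod>i\<in>UNIV. (x $ i) powi (\<alpha> $ i)))"
    by (rule laurent_eval_superset) auto
  ultimately show ?thesis by (simp add: lookup_add distrib_right sum.distrib)
qed

lemma laurent_eval_single:
  "laurent_eval (Poly_Mapping.single \<alpha> c) x = c * (\<Prod>i\<in>UNIV. (x $ i) powi (\<alpha> $ i))"
  by (subst laurent_eval_superset[of "{\<alpha>}"]) auto

lemma laurent_eval_sum: "laurent_eval (\<Sum>a\<in>A. f a) x = (\<Sum>a\<in>A. laurent_eval (f a) x)"
proof (induction A rule: infinite_finite_induct)
  case empty
  show ?case by (simp add: laurent_eval_def)
qed (simp_all add: laurent_eval_add, simp add: laurent_eval_def)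

lemma laurent_eval_pderiv:
  assumes "x $ j \<noteq> 0"
  shows "laurent_eval (laurent_pderiv j f) x
    = (\<Sum>\<alpha>\<in>Poly_Mapping.keys f. of_int (\<alpha> $ j) *
        (Poly_Mapping.lookup f \<alpha> * (\<Prod>i\<in>UNIV. (x $ i) powi (\<alpha> $ i)))) / x $ j"
proof -
  have "(\<Prod>i\<in>UNIV. (x $ i) powi ((\<alpha> - axis j 1) $ i)) = (\<Prod>i\<in>UNIV. (x $ i) powi (\<alpha> $ i)) / x $ j"
    for \<alpha> :: "int ^ 'b"
  proof -
    have "(\<Prod>i\<in>UNIV. (x $ i) powi ((\<alpha> - axis j 1) $ i))
        = (\<Prod>i\<in>UNIV. (x $ i) powi (\<alpha> $ i) / (if i = j then x $ i else 1))"
      by (rule prod.cong) (use assms in \<open>auto simp: axis_def power_int_diff\<close>)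
    also have "\<dots> = (\<Prod>i\<in>UNIV. (x $ i) powi (\<alpha> $ i)) / x $ j"
      by (simp add: prod_dividef)
    finally show ?thesis .
  qed
  then show ?thesis
    by (simp add: laurent_pderiv_def laurent_eval_sum laurent_eval_single sum_divide_distrib ac_simps)
qed

lemma keys_sum_single:
  assumes "finite S"
  shows "Poly_Mapping.keys (\<Sum>\<alpha>\<in>S. Poly_Mapping.single \<alpha> (c \<alpha>)) = {\<alpha> \<in> S. c \<alpha> \<noteq> 0}"
  using assms by (auto simp: in_keys_iff lookup_sum lookup_single when_def split: if_splits)

text \<open>
  At a zero of a binomial the two monomials have opposite values \<open>m\<close> and \<open>-m\<close>, so its partial
  derivative with respect to \<open>X\<^sub>j\<close> is \<open>m (\<alpha>\<^sub>j - \<beta>\<^sub>j) / x\<^sub>j\<close>. The Jacobian matrix is therefore the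
  matrix of exponent differences with rows and columns scaled by units.
\<close>

lemma binomial_system_nondegenerate:
  fixes G :: "'n::finite \<Rightarrow> ('r::field, 'n) laurent_poly"
  assumes ab: "\<And>i. \<alpha> i \<noteq> \<beta> i" and keys: "\<And>i. Poly_Mapping.keys (G i) = {\<alpha> i, \<beta> i}"
    and nz: "(of_int (det (\<chi> i. \<alpha> i - \<beta> i)) :: 'r) \<noteq> 0"
  shows "\<not> degenerate_torus_zero G x"
proof
  assume "degenerate_torus_zero G x"
  then have x: "x $ j \<noteq> 0" and z: "laurent_eval (G i) x = 0"
    and d: "det (\<chi> i j. laurent_eval (laurent_pderiv j (G i)) x) = 0" for i j
    by (auto simp: degenerate_torus_zero_def torus_zero_def)
  define m where "m i \<gamma> = Poly_Mapping.lookup (G i) \<gamma> * (\<Prod>l\<in>UNIV. (x $ l) powi (\<gamma> $ l))" for i \<gamma>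
  have cancel: "m i (\<beta> i) = - m i (\<alpha> i)" for i
    using z[of i] ab[of i] by (simp add: laurent_eval_def keys m_def add_eq_0_iff)
  define M :: "'r ^ 'n ^ 'n" where "M = (\<chi> i j. of_int ((\<chi> i. \<alpha> i - \<beta> i) $ i $ j))"
  have "laurent_eval (laurent_pderiv j (G i)) x = m i (\<alpha> i) * M $ i $ j * inverse (x $ j)" for i j
  proof -
    have "laurent_eval (laurent_pderiv j (G i)) x
        = (of_int (\<alpha> i $ j) * m i (\<alpha> i) + of_int (\<beta> i $ j) * m i (\<beta> i)) / x $ j"
      using ab[of i] x[of j] by (simp add: laurent_eval_pderiv keys m_def)
    then show ?thesis by (simp add: M_def cancel field_simps)
  qed
  with d have "(\<Prod>i\<in>UNIV. m i (\<alpha> i)) * (\<Prod>j\<in>UNIV. inverse (x $ j)) * det M = 0"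
    by (simp add: det_scale_rows_cols)
  moreover have "m i (\<alpha> i) \<noteq> 0" for i
    using keys[of i] x by (auto simp: m_def simp flip: in_keys_iff)
  moreover have "det M \<noteq> 0"
    using nz unfolding M_def of_int_det .
  ultimately show False using x by simp
qed

section \<open>First digits\<close>

text \<open>
  A uniformizer attains the least positive value, so every value is an integral multiple of it;
  the floor is exact and the rescaled element is a unit of the valuation ring. This guarantees
  that passing to the initial form does not lose a monomial.
\<close>

lemma (in complete_discretely_valued_field) first_digit_neq_0:
  assumes unif: "uniformizer v \<pi>" and res: "residue_map v res" and x: "x \<noteq> 0"
  shows "first_digit v \<pi> res x \<noteq> 0"
proof -
  have ev: "v y = ereal (val v y)" if "y \<noteq> 0" for y
    using that v_eq_infinity_iff[of y] v_neq_minus_infinity[of y] by (cases "v y") auto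
  have mult: "val v (y * z) = val v y + val v z" if "y \<noteq> 0" "z \<noteq> 0" for y z
    unfolding v_mult by (subst ev[OF that(1)], subst ev[OF that(2)]) simp
  have one: "val v 1 = 0" using mult[of 1 1] by simp
  have inverse: "val v (inverse y) = - val v y" if "y \<noteq> 0" for y
    using mult[of y "inverse y"] that one by simp
  have pow: "val v (y ^ n) = real n * val v y" if "y \<noteq> 0" for y n
    by (induction n) (use that in \<open>simp_all add: one mult algebra_simps\<close>)
  have powi: "val v (y powi m) = real_of_int m * val v y" if "y \<noteq> 0" for y m
    using that by (cases "m \<ge> 0") (simp_all add: power_int_def pow inverse flip: power_inverse)
  obtain c where c: "c > 0" and vals: "{val v y |y. y \<noteq> 0} = {c * real_of_int m |m. True}"
    using v_discrete by auto
  have multiple: "\<exists>m. val v y = c * real_of_int m" if "y \<noteq> 0" for y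
    using vals that by blast
  obtain y where y: "y \<noteq> 0" "val v y = c"
    using vals by (auto simp: set_eq_iff) (metis mult.right_neutral of_int_1)
  have y_max: "y \<in> maximal_ideal v" using y ev[of y] c by (simp add: maximal_ideal_def)
  then obtain a where a: "y = \<pi> * a" "0 \<le> v a"
    using unif by (auto simp: uniformizer_def valuation_ring_def)
  have nz: "\<pi> \<noteq> 0" "a \<noteq> 0" using a y by auto
  have "\<pi> * 1 \<in> maximal_ideal v"
    using unif ev[of 1] one unfolding uniformizer_def by (auto simp: valuation_ring_def)
  then have pos: "0 < val v \<pi>" using ev[OF nz(1)]
    by (metis ereal_less(2) maximal_ideal_def mem_Collect_eq mult.right_neutral)
  obtain m where m: "val v \<pi> = c * real_of_int m" using multiple[OF nz(1)] by blast
  have "val v \<pi> \<le> c" using mult[OF nz] a y real_of_ereal_pos[OF a(2)] by simp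
  with m c pos have "m = 1" by (auto simp: zero_less_mult_iff)
  with m have \<pi>: "val v \<pi> = c" by simp
  obtain l where l: "val v x = c * real_of_int l" using multiple[OF x] by blast
  let ?u = "\<pi> powi (- \<lfloor>val v x / val v \<pi>\<rfloor>) * x"
  have floor: "\<lfloor>val v x / val v \<pi>\<rfloor> = l" using l \<pi> c by simp
  have "?u \<noteq> 0" using nz x by simp
  moreover have "val v ?u = 0"
    unfolding floor using mult[of "\<pi> powi (- l)" x] powi[of \<pi> "- l"] nz x l \<pi> by simp
  ultimately have "v ?u = 0" using ev[of ?u] by (simp add: zero_ereal_def)
  then have "?u \<in> valuation_ring v" "?u \<notin> maximal_ideal v"
    by (auto simp: valuation_ring_def maximal_ideal_def)
  then show ?thesis
    using res unfolding first_digit_def residue_map_def by blast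
qed

section \<open>Tropical hypersurfaces\<close>

lemma min_exponents_nonempty:
  assumes "Poly_Mapping.keys f \<noteq> {}"
  shows "min_exponents v f w \<noteq> {}"
proof -
  have "tr v f w \<in> trop_term v f w ` Poly_Mapping.keys f"
    unfolding tr_def by (rule Min_in) (use assms in auto)
  then show ?thesis by (auto simp: min_exponents_def)
qed

lemma finite_min_exponents: "finite (min_exponents v f w)"
  by (simp add: min_exponents_def)

text \<open>
  If a single term is minimal at \<open>w\<close>, it stays below all others on a neighbourhood of \<open>w\<close> by
  continuity, and there \<open>tr\<close> is the affine function given by that term.
\<close>

lemma two_minimizers_on_Trop:
  fixes f :: "('k::field, 'n::finite) laurent_poly"
  assumes w: "w \<in> Trop v f" and f: "Poly_Mapping.keys f \<noteq> {}"
  shows "2 \<le> card (min_exponents v f w)"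
proof (rule ccontr)
  assume "\<not> 2 \<le> card (min_exponents v f w)"
  moreover have "card (min_exponents v f w) \<noteq> 0"
    using min_exponents_nonempty[OF f] finite_min_exponents by (simp add: card_eq_0_iff)
  ultimately have "card (min_exponents v f w) = 1" by linarith
  then obtain \<alpha> where \<alpha>: "min_exponents v f w = {\<alpha>}" by (auto simp: card_1_singleton_iff)
  have \<alpha>_key: "\<alpha> \<in> Poly_Mapping.keys f" and \<alpha>_min: "trop_term v f w \<alpha> = tr v f w"
    using \<alpha> by (auto simp: min_exponents_def)
  have cont: "(\<lambda>u. trop_term v f u \<gamma>) \<midarrow>w\<rightarrow> trop_term v f w \<gamma>" for \<gamma>
    unfolding trop_term_def by (intro tendsto_intros)
  have "\<forall>\<^sub>F u in at w. trop_term v f u \<alpha> \<le> trop_term v f u \<gamma>" if "\<gamma> \<in> Poly_Mapping.keys f" for \<gamma>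
  proof (cases "\<gamma> = \<alpha>")
    case False
    have "tr v f w \<le> trop_term v f w \<gamma>" unfolding tr_def using that by simp
    moreover have "trop_term v f w \<gamma> \<noteq> tr v f w"
      using False \<alpha> that by (auto simp: min_exponents_def)
    ultimately have "trop_term v f w \<alpha> < trop_term v f w \<gamma>" using \<alpha>_min by simp
    then have "\<forall>\<^sub>F u in at w. 0 < trop_term v f u \<gamma> - trop_term v f u \<alpha>"
      by (intro order_tendstoD[OF tendsto_diff[OF cont cont]]) simp
    then show ?thesis by (rule eventually_mono) simp
  qed simp
  then have "\<forall>\<^sub>F u in at w. \<forall>\<gamma>\<in>Poly_Mapping.keys f. trop_term v f u \<alpha> \<le> trop_term v f u \<gamma>"
    by (intro eventually_ball_finite) auto
  then have ev: "\<forall>\<^sub>F u in at w. trop_term v f u \<alpha> = tr v f u"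
    by (rule eventually_mono) (use \<alpha>_key in \<open>auto simp: tr_def intro!: Min_eqI[symmetric]\<close>)
  have "((\<lambda>u. trop_term v f u \<alpha>) has_derivative (\<lambda>h. (\<chi> i. real_of_int (\<alpha> $ i)) \<bullet> h)) (at w)"
    unfolding trop_term_def by (auto intro!: derivative_eq_intros)
  then have "(tr v f has_derivative (\<lambda>h. (\<chi> i. real_of_int (\<alpha> $ i)) \<bullet> h)) (at w)"
    by (rule has_derivative_transform_eventually) (use ev \<alpha>_min in auto)
  then show False using w by (auto simp: Trop_def differentiable_def)
qed

section \<open>The Cayley trick\<close>

definition cayley :: "'n \<times> (int ^ 'n::finite) \<Rightarrow> (real ^ 'n) \<times> (real ^ 'n)" where
  "cayley j = (axis (fst j) 1, \<chi> l. real_of_int (snd j $ l))"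

lemma inj_cayley: "inj cayley"
proof (rule injI)
  fix j k :: "'a \<times> (int ^ 'a)"
  assume "cayley j = cayley k"
  then have "axis (fst j) (1::real) = axis (fst k) 1" and "snd j $ l = snd k $ l" for l
    by (auto simp: cayley_def vec_lambda_inject fun_eq_iff)
  then show "j = k"
    unfolding axis_eq_axis by (simp add: prod_eq_iff vec_eq_iff)
qed

lemma cayley_inner: "cayley (i, \<alpha>) \<bullet> (t, p) = t $ i + (\<chi> l. real_of_int (\<alpha> $ l)) \<bullet> p"
  by (simp add: cayley_def inner_axis')

definition active :: "('k::field \<Rightarrow> ereal) \<Rightarrow> ('n \<Rightarrow> ('k, 'n::finite) laurent_poly) \<Rightarrow> real ^ 'n \<Rightarrow>
    ('n \<times> (int ^ 'n)) set" where
  "active v F w = Sigma UNIV (\<lambda>i. min_exponents v (F i) w)"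

text \<open>
  The dual vector with which all active Cayley vectors pair to the valuations of their
  coefficients.
\<close>

definition lift :: "('k::field \<Rightarrow> ereal) \<Rightarrow> ('n \<Rightarrow> ('k, 'n::finite) laurent_poly) \<Rightarrow> real ^ 'n \<Rightarrow>
    (real ^ 'n) \<times> (real ^ 'n)" where
  "lift v F w = (\<chi> i. tr v (F i) w, - w)"

lemma active_cayley:
  assumes "(i, \<alpha>) \<in> active v F w"
  shows "cayley (i, \<alpha>) \<bullet> lift v F w = val v (Poly_Mapping.lookup (F i) \<alpha>)"
  using assms by (auto simp: active_def min_exponents_def lift_def cayley_inner trop_term_def)

text \<open>
  There are at least \<open>2n\<close> active Cayley vectors and at most \<open>2n\<close> independent vectors in the
  ambient space, so equality holds throughout.
\<close>

lemma binomial_and_spanning: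
  fixes F :: "'n::finite \<Rightarrow> ('k::field, 'n) laurent_poly"
  assumes ind: "independent (cayley ` active v F w)"
    and two: "\<And>i. 2 \<le> card (min_exponents v (F i) w)"
  shows "card (min_exponents v (F i) w) = 2" and "span (cayley ` active v F w) = UNIV"
proof -
  let ?n = "\<lambda>i. card (min_exponents v (F i) w)"
  have card: "card (cayley ` active v F w) = sum ?n UNIV"
    by (simp add: card_image inj_on_subset[OF inj_cayley] active_def finite_min_exponents)
  have dim: "DIM((real ^ 'n) \<times> (real ^ 'n)) = (\<Sum>i\<in>(UNIV::'n set). 2)" by simp
  have le: "sum ?n UNIV \<le> (\<Sum>i\<in>(UNIV::'n set). 2)"
    using independent_card_le[OF ind] unfolding card dim .
  show "?n i = 2"
  proof (rule ccontr)
    assume "?n i \<noteq> 2"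
    with two[of i] have "2 < ?n i" by linarith
    then have "(\<Sum>i\<in>(UNIV::'n set). 2) < sum ?n UNIV"
      using two by (intro sum_strict_mono_ex1 bexI[of _ i]) auto
    with le show False by simp
  qed
  have "(\<Sum>i\<in>(UNIV::'n set). 2) \<le> sum ?n UNIV" by (rule sum_mono) (rule two)
  then have "dim (UNIV :: ((real ^ 'n) \<times> (real ^ 'n)) set) \<le> card (cayley ` active v F w)"
    unfolding card dim_UNIV dim .
  with ind show "span (cayley ` active v F w) = UNIV"
    using card_ge_dim_independent[of "cayley ` active v F w" UNIV] by auto
qed

lemma orthogonal_to_spanning:
  fixes p :: "'e::euclidean_space"
  assumes "span S = UNIV" and "\<And>s. s \<in> S \<Longrightarrow> s \<bullet> p = 0"
  shows "p = 0"
proof -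
  have "orthogonal p p"
    by (rule orthogonal_to_span[of p S]) (use assms in \<open>auto simp: orthogonal_def inner_commute\<close>)
  then show ?thesis by (simp add: orthogonal_self)
qed

text \<open>
  Independence of the active Cayley vectors at each \<open>w\<close> is the only genericity that regularity
  requires: on \<open>Trop(F)\<close> it makes them a basis, against which both uniqueness of \<open>w\<close> and
  nonsingularity of the exponent matrix are tested.
\<close>

lemma regular_system_if_active_independent:
  fixes v :: "'k::field \<Rightarrow> ereal" and res :: "'k \<Rightarrow> 'r::field"
    and F :: "'n::finite \<Rightarrow> ('k, 'n) laurent_poly"
  assumes val: "complete_discretely_valued_field v"
    and unif: "uniformizer v \<pi>" and res: "residue_map v res"
    and keys: "\<And>i. Poly_Mapping.keys (F i) \<noteq> {}"
    and char: "\<And>\<alpha> \<beta>. (\<And>i. \<alpha> i \<in> Poly_Mapping.keys (F i) \<and> \<beta> i \<in> Poly_Mapping.keys (F i)) \<Longrightarrow>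
      det (\<chi> i. \<alpha> i - \<beta> i) \<noteq> 0 \<Longrightarrow>
      CHAR('r) = 0 \<or> coprime (int CHAR('r)) (det (\<chi> i. \<alpha> i - \<beta> i))"
    and ind: "\<And>w. independent (cayley ` active v F w)"
  shows "regular_system v \<pi> res F"
proof -
  have two: "2 \<le> card (min_exponents v (F i) w)" if "w \<in> Trop_system v F" for i w
    using that two_minimizers_on_Trop[OF _ keys] by (auto simp: Trop_system_def)
  note span = binomial_and_spanning(2)[OF ind two]
  \<comment> \<open>Finiteness: if the same terms are active at \<open>w\<close> and \<open>w'\<close>, both lifts pair equally with a basis.\<close>
  have "inj_on (active v F) (Trop_system v F)"
  proof (rule inj_onI)
    fix w w' assume w: "w \<in> Trop_system v F" and eq: "active v F w = active v F w'"
    have "s \<bullet> (lift v F w - lift v F w') = 0" if s: "s \<in> cayley ` active v F w" for s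
    proof -
      obtain i \<alpha> where i: "(i, \<alpha>) \<in> active v F w" "s = cayley (i, \<alpha>)" using s by auto
      with eq have "(i, \<alpha>) \<in> active v F w'" by simp
      from active_cayley[OF this] active_cayley[OF i(1)] i(2) show ?thesis
        by (simp add: inner_diff_right)
    qed
    then have "lift v F w - lift v F w' = 0"
      by (rule orthogonal_to_spanning[OF span[OF w]])
    then show "w = w'" by (simp add: lift_def prod_eq_iff)
  qed
  moreover have "active v F ` Trop_system v F \<subseteq> Pow (Sigma UNIV (\<lambda>i. Poly_Mapping.keys (F i)))"
    by (auto simp: active_def min_exponents_def)
  then have "finite (active v F ` Trop_system v F)" by (rule finite_subset) simp
  ultimately have "finite (Trop_system v F)" using finite_image_iff by blast
  moreover have "is_binomial (lower_poly v w (F i))" if "w \<in> Trop_system v F" for w i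
  proof -
    have "Poly_Mapping.keys (lower_poly v w (F i)) = min_exponents v (F i) w"
      unfolding lower_poly_def keys_sum_single[OF finite_min_exponents]
      by (auto simp: min_exponents_def in_keys_iff)
    then show ?thesis
      using binomial_and_spanning(1)[OF ind two[OF that]] by (simp add: is_binomial_def)
  qed
  moreover have "semiregular_at v \<pi> res F w" if w: "w \<in> Trop_system v F" for w
  proof -
    have "\<forall>i. \<exists>\<alpha> \<beta>. min_exponents v (F i) w = {\<alpha>, \<beta>} \<and> \<alpha> \<noteq> \<beta>"
      using binomial_and_spanning(1)[OF ind two[OF w]] by (simp add: card_2_iff)
    then obtain \<alpha> \<beta> where ab: "\<And>i. min_exponents v (F i) w = {\<alpha> i, \<beta> i}" "\<And>i. \<alpha> i \<noteq> \<beta> i"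
      by metis
    define M :: "real ^ 'n ^ 'n" where "M = (\<chi> i j. real_of_int ((\<chi> i. \<alpha> i - \<beta> i) $ i $ j))"
    have "p = 0" if p: "M *v p = 0" for p
    proof -
      \<comment> \<open>The first component is chosen so that \<open>q\<close> is orthogonal to the Cayley vectors of the
        \<open>\<alpha> i\<close>; as \<open>p\<close> lies in the kernel, \<open>q\<close> is then orthogonal to those of the \<open>\<beta> i\<close> as well.\<close>
      define q where "q = (\<chi> i. - ((\<chi> l. real_of_int (\<alpha> i $ l)) \<bullet> p), p)"
      have diff: "(\<chi> l. real_of_int (\<alpha> i $ l)) \<bullet> p = (\<chi> l. real_of_int (\<beta> i $ l)) \<bullet> p" for i
      proof -
        have "(M *v p) $ i = (\<chi> l. real_of_int (\<alpha> i $ l)) \<bullet> p - (\<chi> l. real_of_int (\<beta> i $ l)) \<bullet> p"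
          by (simp add: M_def matrix_vector_mult_def inner_vec_def sum_subtractf algebra_simps)
        with p show ?thesis by simp
      qed
      have "s \<bullet> q = 0" if s: "s \<in> cayley ` active v F w" for s
        using s diff by (auto simp: active_def ab(1) q_def cayley_inner)
      then have "q = 0" by (rule orthogonal_to_spanning[OF span[OF w]])
      then show ?thesis by (simp add: q_def prod_eq_iff)
    qed
    then have "det M \<noteq> 0" 
      using matrix_left_invertible_ker[of M] invertible_det_nz[of M] invertible_left_inverse[of M]
      by blast
    then have det: "det (\<chi> i. \<alpha> i - \<beta> i) \<noteq> 0"
      unfolding M_def of_int_det[symmetric] by simp
    have "\<alpha> i \<in> Poly_Mapping.keys (F i) \<and> \<beta> i \<in> Poly_Mapping.keys (F i)" for i
      using ab(1)[of i] by (auto simp: min_exponents_def)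
    from of_int_neq_0_of_coprime_char[OF det char[OF this det]]
    have unit: "(of_int (det (\<chi> i. \<alpha> i - \<beta> i)) :: 'r) \<noteq> 0" .
    have "Poly_Mapping.keys (initial_form v \<pi> res w (F i)) = {\<alpha> i, \<beta> i}" for i
    proof -
      have "first_digit v \<pi> res (Poly_Mapping.lookup (F i) \<gamma>) \<noteq> 0"
        if "\<gamma> \<in> min_exponents v (F i) w" for \<gamma>
        using that complete_discretely_valued_field.first_digit_neq_0[OF val unif res]
        by (auto simp: min_exponents_def in_keys_iff)
      then show ?thesis
        unfolding initial_form_def keys_sum_single[OF finite_min_exponents] ab(1)[symmetric] by auto
    qed
    from binomial_system_nondegenerate[OF ab(2) this unit]
    show ?thesis by (auto simp: semiregular_at_def)
  qed
  ultimately show ?thesis by (simp add: regular_system_def)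
qed

theorem corollary5p3:
  fixes v :: "'k::field \<Rightarrow> ereal"
    and \<pi> :: 'k
    and res :: "'k \<Rightarrow> 'r::field"
    and \<A> :: "'n::finite \<Rightarrow> (int ^ 'n) set"
  assumes "complete_discretely_valued_field v"
    and "uniformizer v \<pi>"
    and "residue_map v res"
    and "\<And>i. finite (\<A> i)"
    and "\<And>i. \<A> i \<noteq> {}"
    and "CHAR('r) = 0 \<or>
      (\<forall>\<alpha> \<beta>. (\<forall>i. \<alpha> i \<in> \<A> i \<and> \<beta> i \<in> \<A> i) \<longrightarrow>
        det (\<chi> i. \<alpha> i - \<beta> i) \<noteq> 0 \<longrightarrow>
        coprime (int CHAR('r)) (det (\<chi> i. \<alpha> i - \<beta> i)))"
  shows "tropically_generic v (Sigma UNIV \<A>) (\<lambda>x. regular_system v \<pi> res (system_of \<A> x))"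
proof -
  let ?I = "Sigma UNIV \<A>"
  have fin: "finite ?I" using assms(4) by simp
  obtain \<H> where \<H>: "finite \<H>" "\<forall>H\<in>\<H>. affine_hyperplane ?I H"
    and gen: "\<And>y p. y \<in> ?I \<rightarrow>\<^sub>E UNIV \<Longrightarrow> y \<notin> \<Union>\<H> \<Longrightarrow>
      independent (cayley ` {j \<in> ?I. cayley j \<bullet> p = y j})"
    using generic_equations_independent[OF fin inj_on_subset[OF inj_cayley subset_UNIV]] by blast
  have "regular_system v \<pi> res (system_of \<A> x)"
    if x: "x \<in> ?I \<rightarrow>\<^sub>E (UNIV - {0})" and out: "(\<lambda>j\<in>?I. val v (x j)) \<notin> \<Union>\<H>" for x
  proof (rule regular_system_if_active_independent[OF assms(1-3)])
    note lk = lookup_system_of[of \<A> _ x, OF assms(4)]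
    have keys: "Poly_Mapping.keys (system_of \<A> x i) = \<A> i" for i
      using bij_betw_imp_surj_on[OF bij_betw_system_of[of \<A>, OF assms(4)]] x by blast
    show "Poly_Mapping.keys (system_of \<A> x i) \<noteq> {}" for i
      using assms(5) by (simp add: keys)
    show "CHAR('r) = 0 \<or> coprime (int CHAR('r)) (det (\<chi> i. \<alpha> i - \<beta> i))"
      if "\<And>i. \<alpha> i \<in> Poly_Mapping.keys (system_of \<A> x i) \<and> \<beta> i \<in> Poly_Mapping.keys (system_of \<A> x i)"
        and "det (\<chi> i. \<alpha> i - \<beta> i) \<noteq> 0" for \<alpha> \<beta>
      using assms(6) that unfolding keys by blast
    fix w
    have "active v (system_of \<A> x) w
        \<subseteq> {j \<in> ?I. cayley j \<bullet> lift v (system_of \<A> x) w = (\<lambda>j\<in>?I. val v (x j)) j}"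
    proof
      fix j assume j: "j \<in> active v (system_of \<A> x) w"
      obtain i \<alpha> where [simp]: "j = (i, \<alpha>)" by (cases j)
      have "\<alpha> \<in> \<A> i" using j by (auto simp: active_def min_exponents_def keys)
      with active_cayley[of i \<alpha> v "system_of \<A> x" w] j
      show "j \<in> {j \<in> ?I. cayley j \<bullet> lift v (system_of \<A> x) w = (\<lambda>j\<in>?I. val v (x j)) j}"
        by (simp add: lk)
    qed
    then show "independent (cayley ` active v (system_of \<A> x) w)"
      using gen[OF _ out, of "lift v (system_of \<A> x) w"]
      by (meson image_mono independent_mono restrict_PiE_iff UNIV_I)
  qed
  then have "{\<lambda>j\<in>?I. val v (x j) |x. x \<in> ?I \<rightarrow>\<^sub>E (UNIV - {0}) \<and>
      \<not> regular_system v \<pi> res (system_of \<A> x)} \<subseteq> \<Union>\<H>"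
    by auto
  with \<H> show ?thesis
    unfolding tropically_generic_def by (intro exI[of _ \<H>] conjI)
qed

end
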